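(* Let $C$ be a regular protomodular category with an initial object $0$. Then the Noetherian objects of $C$ are Hopfian, and they are closed under subobjects, regular quotients and weak extensions. Moreover, if $C$ is pointed, then the Noetherian objects of $C$ are closed under binary products.
   Context: A category is regular if it is finitely complete and each morphism factors as $me$ with $m$ monic and $e$ a stably extremal epimorphism. Here a morphism $e$ is an extremal epimorphism if $e=mg$ with $m$ monic implies that $m$ is an isomorphism, and it is stably extremal if every pullback of it is an extremal epimorphism. A category with pullbacks is protomodular if the following holds: given morphisms $m'\colon a'\to b'$, $e'\colon b'\to c'$, $m\colon a\to b$, $e\colon b\to c$, $\alpha\colon a'\to a$, $\beta\colon b'\to b$, $\gamma\colon c'\to c$ with $\beta m'=m\alpha$ a pullback square, $e\beta=\gamma e'$, $m$ a pullback along $e$ of some morphism $\theta\colon w\to c$, $e,e'$ retractions (split epimorphisms), and $\alpha,\gamma$ isomorphisms, then $\beta$ is an isomorphism. Pointed means having a zero object. An object $c$ is Noetherian if for every (covariant) functor $F\colon\mathbb N\to C/c$ from the poset $\mathbb N$ such that each structure morphism $F(n)\colon c_n\to c$ is monic, there is $i_0\in\mathbb N$ such that $F(i\to j)$ is an isomorphism for all $i_0\le i\le j$. An object $c$ is Hopfian if every stably extremal epimorphism $c\to c$ is an isomorphism. A class $X$ of objects is closed under subobjects if $b\in X$ and $a\to b$ monic imply $a\in X$; closed under regular quotients if $a\in X$ and $a\to b$ a regular epimorphism imply $b\in X$; closed under weak extensions if for every pullback square with $\bar f\colon a\to d$, $\bar\phi\colon a\to b$, $f\colon b\to c$, $\phi\colon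 d\to c$ (with $f$ and $\phi$ arbitrary) and $a,c\in X$, one has $b\in X$. *)

theory Defs
  imports Main
begin

section \<open>Categories and functors\<close>

record ('o, 'm) cat =
  Obj :: "'o set"
  Arr :: "'m set"
  Dom :: "'m \<Rightarrow> 'o"
  Cod :: "'m \<Rightarrow> 'o"
  Ident :: "'o \<Rightarrow> 'm"
  Comp :: "'m \<Rightarrow> 'm \<Rightarrow> 'm"  (infixl "\<cdot>\<index>" 70)

text \<open>Composition is in applicative order, and is meaningful only on composable pairs of arrows;
  nothing is assumed about values outside the carriers.\<close>

definition in_hom :: "('o, 'm) cat \<Rightarrow> 'm \<Rightarrow> 'o \<Rightarrow> 'o \<Rightarrow> bool" where
  "in_hom C f a b \<longleftrightarrow> f \<in> Arr C \<and> Dom C f = a \<and> Cod C f = b"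

locale category =
  fixes C :: "('o, 'm) cat" (structure)
  assumes dom_obj: "f \<in> Arr C \<Longrightarrow> Dom C f \<in> Obj C"
    and cod_obj: "f \<in> Arr C \<Longrightarrow> Cod C f \<in> Obj C"
    and ident_in_hom: "a \<in> Obj C \<Longrightarrow> in_hom C (Ident C a) a a"
    and comp_in_hom: "in_hom C f a b \<Longrightarrow> in_hom C g b c \<Longrightarrow> in_hom C (g \<cdot> f) a c"
    and comp_ident: "in_hom C f a b \<Longrightarrow> f \<cdot> Ident C a = f"
    and ident_comp: "in_hom C f a b \<Longrightarrow> Ident C b \<cdot> f = f"
    and comp_assoc:
      "in_hom C f a b \<Longrightarrow> in_hom C g b c \<Longrightarrow> in_hom C h c d \<Longrightarrow> h \<cdot> g \<cdot> f = h \<cdot> (g \<cdot> f)"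

definition is_functor ::
  "('i, 'j) cat \<Rightarrow> ('o, 'm) cat \<Rightarrow> ('i \<Rightarrow> 'o) \<Rightarrow> ('j \<Rightarrow> 'm) \<Rightarrow> bool" where
  "is_functor J C Fo Fm \<longleftrightarrow>
     (\<forall>i\<in>Obj J. Fo i \<in> Obj C) \<and>
     (\<forall>u i j. in_hom J u i j \<longrightarrow> in_hom C (Fm u) (Fo i) (Fo j)) \<and>
     (\<forall>i\<in>Obj J. Fm (Ident J i) = Ident C (Fo i)) \<and>
     (\<forall>u v i j k. in_hom J u i j \<longrightarrow> in_hom J v j k \<longrightarrow>
        Fm (v \<cdot>\<^bsub>J\<^esub> u) = Fm v \<cdot>\<^bsub>C\<^esub> Fm u)"

text \<open>The poset of natural numbers as a category: \<open>(i, j)\<close> with \<open>i \<le> j\<close> is the unique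
  arrow \<open>i \<rightarrow> j\<close>.\<close>

definition nat_poset :: "(nat, nat \<times> nat) cat" where
  "nat_poset =
     \<lparr> Obj = UNIV, Arr = {(i, j). i \<le> j}, Dom = fst, Cod = snd,
       Ident = (\<lambda>i. (i, i)), Comp = (\<lambda>v u. (fst u, snd v)) \<rparr>"

text \<open>The slice category \<open>C/c\<close>: objects are the arrows with codomain \<open>c\<close>; an arrow \<open>p \<rightarrow> q\<close>
  is a triple \<open>(p, f, q)\<close> with \<open>q \<cdot> f = p\<close>, so that it determines its domain and codomain.\<close>

definition slice :: "('o, 'm) cat \<Rightarrow> 'o \<Rightarrow> ('m, 'm \<times> 'm \<times> 'm) cat" where
  "slice C c =
     \<lparr> Obj = {p \<in> Arr C. Cod C p = c},
       Arr = {(p, f, q). p \<in> Arr C \<and> Cod C p = c \<and> q \<in> Arr C \<and> Cod C q = c \<and>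
                in_hom C f (Dom C p) (Dom C q) \<and> q \<cdot>\<^bsub>C\<^esub> f = p},
       Dom = (\<lambda>(p, f, q). p), Cod = (\<lambda>(p, f, q). q),
       Ident = (\<lambda>p. (p, Ident C (Dom C p), p)),
       Comp = (\<lambda>(q', g, r) (p, f, q). (p, g \<cdot>\<^bsub>C\<^esub> f, r)) \<rparr>"

lemma category_nat_poset: "category nat_poset"
  by unfold_locales (auto simp: nat_poset_def in_hom_def)

lemma in_hom_slice:
  "in_hom (slice C c) u p q \<longleftrightarrow>
     (\<exists>f. u = (p, f, q) \<and> p \<in> Arr C \<and> Cod C p = c \<and> q \<in> Arr C \<and> Cod C q = c \<and>
        in_hom C f (Dom C p) (Dom C q) \<and> q \<cdot>\<^bsub>C\<^esub> f = p)"
  unfolding in_hom_def slice_def by auto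

lemma (in category) category_slice: "category (slice C c)"
proof
  fix f assume "f \<in> Arr (slice C c)"
  then show "Dom (slice C c) f \<in> Obj (slice C c)" "Cod (slice C c) f \<in> Obj (slice C c)"
    by (auto simp: slice_def)
next
  fix p assume "p \<in> Obj (slice C c)"
  then show "in_hom (slice C c) (Ident (slice C c) p) p p"
    using ident_in_hom[OF dom_obj[of p]] comp_ident[of p "Dom C p" c]
    by (auto simp: slice_def in_hom_def)
next
  fix u v p q r
  assume "in_hom (slice C c) u p q" "in_hom (slice C c) v q r"
  then obtain f g where uv: "u = (p, f, q)" "v = (q, g, r)"
    and p: "p \<in> Arr C" "Cod C p = c" and r: "r \<in> Arr C" "Cod C r = c"
    and f: "in_hom C f (Dom C p) (Dom C q)" "q \<cdot> f = p"
    and g: "in_hom C g (Dom C q) (Dom C r)" "r \<cdot> g = q"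
    by (auto simp: in_hom_slice)
  have "in_hom C r (Dom C r) c"
    using r by (simp add: in_hom_def)
  from comp_assoc[OF f(1) g(1) this] have "r \<cdot> (g \<cdot> f) = p"
    using f g by simp
  then show "in_hom (slice C c) (v \<cdot>\<^bsub>slice C c\<^esub> u) p r"
    using comp_in_hom[OF f(1) g(1)] p r uv unfolding in_hom_slice by (simp add: slice_def)
next
  fix u p q
  assume "in_hom (slice C c) u p q"
  then obtain f where u: "u = (p, f, q)" and f: "in_hom C f (Dom C p) (Dom C q)"
    by (auto simp: in_hom_slice)
  show "u \<cdot>\<^bsub>slice C c\<^esub> Ident (slice C c) p = u" "Ident (slice C c) q \<cdot>\<^bsub>slice C c\<^esub> u = u"
    using comp_ident[OF f] ident_comp[OF f] by (simp_all add: slice_def u)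
next
  fix u v w p q r s
  assume "in_hom (slice C c) u p q" "in_hom (slice C c) v q r" "in_hom (slice C c) w r s"
  then obtain f g h where uvw: "u = (p, f, q)" "v = (q, g, r)" "w = (r, h, s)"
    and fgh: "in_hom C f (Dom C p) (Dom C q)" "in_hom C g (Dom C q) (Dom C r)"
      "in_hom C h (Dom C r) (Dom C s)"
    by (auto simp: in_hom_slice)
  show "w \<cdot>\<^bsub>slice C c\<^esub> v \<cdot>\<^bsub>slice C c\<^esub> u = w \<cdot>\<^bsub>slice C c\<^esub> (v \<cdot>\<^bsub>slice C c\<^esub> u)"
    using comp_assoc[OF fgh] by (simp add: slice_def uvw)
qed

section \<open>Special arrows\<close>

definition iso :: "('o, 'm) cat \<Rightarrow> 'm \<Rightarrow> bool" where
  "iso C f \<longleftrightarrow> f \<in> Arr C \<and>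
     (\<exists>g. in_hom C g (Cod C f) (Dom C f) \<and>
        g \<cdot>\<^bsub>C\<^esub> f = Ident C (Dom C f) \<and> f \<cdot>\<^bsub>C\<^esub> g = Ident C (Cod C f))"

definition monic :: "('o, 'm) cat \<Rightarrow> 'm \<Rightarrow> bool" where
  "monic C m \<longleftrightarrow> m \<in> Arr C \<and>
     (\<forall>x u v. in_hom C u x (Dom C m) \<longrightarrow> in_hom C v x (Dom C m) \<longrightarrow>
        m \<cdot>\<^bsub>C\<^esub> u = m \<cdot>\<^bsub>C\<^esub> v \<longrightarrow> u = v)"

definition retraction :: "('o, 'm) cat \<Rightarrow> 'm \<Rightarrow> bool" where
  "retraction C e \<longleftrightarrow> e \<in> Arr C \<and>
     (\<exists>s. in_hom C s (Cod C e) (Dom C e) \<and> e \<cdot>\<^bsub>C\<^esub> s = Ident C (Cod C e))"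

definition regular_epi :: "('o, 'm) cat \<Rightarrow> 'm \<Rightarrow> bool" where
  "regular_epi C e \<longleftrightarrow> e \<in> Arr C \<and>
     (\<exists>r u v. in_hom C u r (Dom C e) \<and> in_hom C v r (Dom C e) \<and> e \<cdot>\<^bsub>C\<^esub> u = e \<cdot>\<^bsub>C\<^esub> v \<and>
        (\<forall>x h. in_hom C h (Dom C e) x \<longrightarrow> h \<cdot>\<^bsub>C\<^esub> u = h \<cdot>\<^bsub>C\<^esub> v \<longrightarrow>
           (\<exists>!k. in_hom C k (Cod C e) x \<and> k \<cdot>\<^bsub>C\<^esub> e = h)))"

text \<open>\<open>pullback_square C p q f g\<close>: the square \<open>f \<cdot> p = g \<cdot> q\<close> is a pullback, i.e. \<open>p\<close> is a
  pullback of \<open>g\<close> along \<open>f\<close> and \<open>q\<close> is a pullback of \<open>f\<close> along \<open>g\<close>.\<close>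

definition pullback_square :: "('o, 'm) cat \<Rightarrow> 'm \<Rightarrow> 'm \<Rightarrow> 'm \<Rightarrow> 'm \<Rightarrow> bool" where
  "pullback_square C p q f g \<longleftrightarrow>
     p \<in> Arr C \<and> q \<in> Arr C \<and> f \<in> Arr C \<and> g \<in> Arr C \<and>
     Dom C p = Dom C q \<and> Cod C p = Dom C f \<and> Cod C q = Dom C g \<and> Cod C f = Cod C g \<and>
     f \<cdot>\<^bsub>C\<^esub> p = g \<cdot>\<^bsub>C\<^esub> q \<and>
     (\<forall>x u v. in_hom C u x (Dom C f) \<longrightarrow> in_hom C v x (Dom C g) \<longrightarrow>
        f \<cdot>\<^bsub>C\<^esub> u = g \<cdot>\<^bsub>C\<^esub> v \<longrightarrow>
        (\<exists>!h. in_hom C h x (Dom C p) \<and> p \<cdot>\<^bsub>C\<^esub> h = u \<and> q \<cdot>\<^bsub>C\<^esub> h = v))"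

definition extremal_epi :: "('o, 'm) cat \<Rightarrow> 'm \<Rightarrow> bool" where
  "extremal_epi C e \<longleftrightarrow> e \<in> Arr C \<and>
     (\<forall>m g. monic C m \<longrightarrow> in_hom C g (Dom C e) (Dom C m) \<longrightarrow> Cod C m = Cod C e \<longrightarrow>
        e = m \<cdot>\<^bsub>C\<^esub> g \<longrightarrow> iso C m)"

definition stably_extremal_epi :: "('o, 'm) cat \<Rightarrow> 'm \<Rightarrow> bool" where
  "stably_extremal_epi C e \<longleftrightarrow> e \<in> Arr C \<and>
     (\<forall>e' g' g. pullback_square C e' g' g e \<longrightarrow> extremal_epi C e')"

section \<open>Limits and special objects\<close>

definition cone ::
  "('i, 'j) cat \<Rightarrow> ('o, 'm) cat \<Rightarrow> ('i \<Rightarrow> 'o) \<Rightarrow> ('j \<Rightarrow> 'm) \<Rightarrow> 'o \<Rightarrow> ('i \<Rightarrow> 'm) \<Rightarrow> bool" where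
  "cone J C Fo Fm a \<pi> \<longleftrightarrow>
     a \<in> Obj C \<and> (\<forall>i\<in>Obj J. in_hom C (\<pi> i) a (Fo i)) \<and>
     (\<forall>u i j. in_hom J u i j \<longrightarrow> Fm u \<cdot>\<^bsub>C\<^esub> \<pi> i = \<pi> j)"

definition limit_cone ::
  "('i, 'j) cat \<Rightarrow> ('o, 'm) cat \<Rightarrow> ('i \<Rightarrow> 'o) \<Rightarrow> ('j \<Rightarrow> 'm) \<Rightarrow> 'o \<Rightarrow> ('i \<Rightarrow> 'm) \<Rightarrow> bool" where
  "limit_cone J C Fo Fm a \<pi> \<longleftrightarrow>
     cone J C Fo Fm a \<pi> \<and>
     (\<forall>x \<rho>. cone J C Fo Fm x \<rho> \<longrightarrow>
        (\<exists>!h. in_hom C h x a \<and> (\<forall>i\<in>Obj J. \<pi> i \<cdot>\<^bsub>C\<^esub> h = \<rho> i)))"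

text \<open>Index categories are taken with objects and arrows in \<^typ>\<open>nat\<close>; every finite category
  is isomorphic to one of these.\<close>

definition finitely_complete :: "('o, 'm) cat \<Rightarrow> bool" where
  "finitely_complete C \<longleftrightarrow>
     (\<forall>(J :: (nat, nat) cat) Fo Fm.
        category J \<longrightarrow> finite (Obj J) \<longrightarrow> finite (Arr J) \<longrightarrow> is_functor J C Fo Fm \<longrightarrow>
        (\<exists>a \<pi>. limit_cone J C Fo Fm a \<pi>))"

definition has_pullbacks :: "('o, 'm) cat \<Rightarrow> bool" where
  "has_pullbacks C \<longleftrightarrow>
     (\<forall>f\<in>Arr C. \<forall>g\<in>Arr C. Cod C f = Cod C g \<longrightarrow> (\<exists>p q. pullback_square C p q f g))"

definition initial_object :: "('o, 'm) cat \<Rightarrow> 'o \<Rightarrow> bool" where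
  "initial_object C z \<longleftrightarrow> z \<in> Obj C \<and> (\<forall>a\<in>Obj C. \<exists>!f. in_hom C f z a)"

definition terminal_object :: "('o, 'm) cat \<Rightarrow> 'o \<Rightarrow> bool" where
  "terminal_object C t \<longleftrightarrow> t \<in> Obj C \<and> (\<forall>a\<in>Obj C. \<exists>!f. in_hom C f a t)"

definition pointed :: "('o, 'm) cat \<Rightarrow> bool" where
  "pointed C \<longleftrightarrow> (\<exists>z. initial_object C z \<and> terminal_object C z)"

definition binary_product :: "('o, 'm) cat \<Rightarrow> 'o \<Rightarrow> 'o \<Rightarrow> 'o \<Rightarrow> 'm \<Rightarrow> 'm \<Rightarrow> bool" where
  "binary_product C a b p \<pi>\<^sub>1 \<pi>\<^sub>2 \<longleftrightarrow>
     in_hom C \<pi>\<^sub>1 p a \<and> in_hom C \<pi>\<^sub>2 p b \<and>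
     (\<forall>x u v. in_hom C u x a \<longrightarrow> in_hom C v x b \<longrightarrow>
        (\<exists>!h. in_hom C h x p \<and> \<pi>\<^sub>1 \<cdot>\<^bsub>C\<^esub> h = u \<and> \<pi>\<^sub>2 \<cdot>\<^bsub>C\<^esub> h = v))"

section \<open>Regular and protomodular categories\<close>

definition regular_category :: "('o, 'm) cat \<Rightarrow> bool" where
  "regular_category C \<longleftrightarrow>
     category C \<and> finitely_complete C \<and>
     (\<forall>f\<in>Arr C. \<exists>m e. monic C m \<and> stably_extremal_epi C e \<and>
        Cod C e = Dom C m \<and> f = m \<cdot>\<^bsub>C\<^esub> e)"

definition protomodular_category :: "('o, 'm) cat \<Rightarrow> bool" where
  "protomodular_category C \<longleftrightarrow>
     category C \<and> has_pullbacks C \<and>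
     (\<forall>a' b' c' a b c m' e' m e \<alpha> \<beta> \<gamma>.
        in_hom C m' a' b' \<longrightarrow> in_hom C e' b' c' \<longrightarrow>
        in_hom C m a b \<longrightarrow> in_hom C e b c \<longrightarrow>
        in_hom C \<alpha> a' a \<longrightarrow> in_hom C \<beta> b' b \<longrightarrow> in_hom C \<gamma> c' c \<longrightarrow>
        pullback_square C m' \<alpha> \<beta> m \<longrightarrow>
        e \<cdot>\<^bsub>C\<^esub> \<beta> = \<gamma> \<cdot>\<^bsub>C\<^esub> e' \<longrightarrow>
        (\<exists>w \<theta> h. in_hom C \<theta> w c \<and> pullback_square C m h e \<theta>) \<longrightarrow>
        retraction C e \<longrightarrow> retraction C e' \<longrightarrow>
        iso C \<alpha> \<longrightarrow> iso C \<gamma> \<longrightarrow>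
        iso C \<beta>)"

section \<open>Noetherian and Hopfian objects, closure properties\<close>

definition noetherian_object :: "('o, 'm) cat \<Rightarrow> 'o \<Rightarrow> bool" where
  "noetherian_object C c \<longleftrightarrow> c \<in> Obj C \<and>
     (\<forall>Fo Fm. is_functor nat_poset (slice C c) Fo Fm \<longrightarrow> (\<forall>n. monic C (Fo n)) \<longrightarrow>
        (\<exists>i\<^sub>0. \<forall>i j. i\<^sub>0 \<le> i \<longrightarrow> i \<le> j \<longrightarrow> iso (slice C c) (Fm (i, j))))"

definition hopfian_object :: "('o, 'm) cat \<Rightarrow> 'o \<Rightarrow> bool" where
  "hopfian_object C c \<longleftrightarrow> c \<in> Obj C \<and>
     (\<forall>e. in_hom C e c c \<longrightarrow> stably_extremal_epi C e \<longrightarrow> iso C e)"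

definition closed_under_subobjects :: "('o, 'm) cat \<Rightarrow> 'o set \<Rightarrow> bool" where
  "closed_under_subobjects C X \<longleftrightarrow>
     (\<forall>a b m. b \<in> X \<longrightarrow> in_hom C m a b \<longrightarrow> monic C m \<longrightarrow> a \<in> X)"

definition closed_under_regular_quotients :: "('o, 'm) cat \<Rightarrow> 'o set \<Rightarrow> bool" where
  "closed_under_regular_quotients C X \<longleftrightarrow>
     (\<forall>a b e. a \<in> X \<longrightarrow> in_hom C e a b \<longrightarrow> regular_epi C e \<longrightarrow> b \<in> X)"

definition closed_under_weak_extensions :: "('o, 'm) cat \<Rightarrow> 'o set \<Rightarrow> bool" where
  "closed_under_weak_extensions C X \<longleftrightarrow>
     (\<forall>a b c d f' \<phi>' f \<phi>.
        in_hom C f' a d \<longrightarrow> in_hom C \<phi>' a b \<longrightarrow> in_hom C f b c \<longrightarrow> in_hom C \<phi> d c \<longrightarrow>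
        pullback_square C \<phi>' f' f \<phi> \<longrightarrow> a \<in> X \<longrightarrow> c \<in> X \<longrightarrow> b \<in> X)"

definition closed_under_binary_products :: "('o, 'm) cat \<Rightarrow> 'o set \<Rightarrow> bool" where
  "closed_under_binary_products C X \<longleftrightarrow>
     (\<forall>a b p \<pi>\<^sub>1 \<pi>\<^sub>2. a \<in> X \<longrightarrow> b \<in> X \<longrightarrow> binary_product C a b p \<pi>\<^sub>1 \<pi>\<^sub>2 \<longrightarrow> p \<in> X)"

end

theory Submission imports Defs begin

text \<open>Noetherian means that ascending sequences of subobjects stabilize.

  For a cover \<open>e : c \<rightarrow> c\<close> let \<open>i : I \<rightarrow> c\<close> be the image of \<open>0 \<rightarrow> c\<close>. Then \<open>e i = i\<close>, so the
  preimages of \<open>I\<close> under the powers of \<open>e\<close> ascend; once they stabilize, \<open>e\<^sup>-\<^sup>1(I) = I\<close>, and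
  protomodularity, applied to the diagonal of \<open>c\<close> into the kernel pair of \<open>e\<close>, makes \<open>e\<close> monic.

  In a weak extension, given an ascending sequence of subobjects of \<open>b\<close>, both its preimages in \<open>a\<close>
  and its images in \<open>c\<close> stabilize. If \<open>K \<le> L\<close> are subobjects of \<open>b\<close> with the same preimage and the
  same image, then \<open>K \<times>\<^sub>c K \<rightarrow> K \<times>\<^sub>c L\<close> is invertible by protomodularity. Since \<open>K\<close> and \<open>L\<close> cover
  the same image, \<open>L\<close> is covered by \<open>K \<times>\<^sub>c L\<close>, hence \<open>K = L\<close>. A product is a weak extension in a
  pointed category, by the kernel of a projection.\<close>

text \<open>Among monics with a common codomain this is the inclusion of subobjects. The arrow
  \<open>k\<close> may also be arbitrary; it then lands in the subobject \<open>m\<close>.\<close>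

definition factors_through :: "('o, 'm) cat \<Rightarrow> 'm \<Rightarrow> 'm \<Rightarrow> bool" where
  "factors_through C k m \<longleftrightarrow> (\<exists>v. in_hom C v (Dom C k) (Dom C m) \<and> k = m \<cdot>\<^bsub>C\<^esub> v)"

lemma in_hom_nat_poset: "in_hom nat_poset u i j \<longleftrightarrow> u = (i, j) \<and> i \<le> j"
  by (cases u) (auto simp: in_hom_def nat_poset_def)

section \<open>Arrows, monics, isomorphisms and pullback squares\<close>

context category
begin

lemma in_hom_arr: "in_hom C f a b \<Longrightarrow> f \<in> Arr C"
  by (simp add: in_hom_def)

lemma in_hom_dom: "in_hom C f a b \<Longrightarrow> Dom C f = a"
  by (simp add: in_hom_def)

lemma in_hom_cod: "in_hom C f a b \<Longrightarrow> Cod C f = b"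
  by (simp add: in_hom_def)

lemma in_hom_dom_obj: "in_hom C f a b \<Longrightarrow> a \<in> Obj C"
  using dom_obj by (auto simp: in_hom_def)

lemma in_hom_cod_obj: "in_hom C f a b \<Longrightarrow> b \<in> Obj C"
  using cod_obj by (auto simp: in_hom_def)

lemma ident_hom: "in_hom C f a b \<Longrightarrow> in_hom C (Ident C a) a a"
  using in_hom_dom_obj ident_in_hom by blast

lemma monicI:
  assumes "in_hom C m a b"
    and "\<And>x u v. in_hom C u x a \<Longrightarrow> in_hom C v x a \<Longrightarrow> m \<cdot> u = m \<cdot> v \<Longrightarrow> u = v"
  shows "monic C m"
  using assms unfolding monic_def in_hom_def by metis

lemma monic_cancel:
  assumes "monic C m" "in_hom C m a b" "in_hom C u x a" "in_hom C v x a" "m \<cdot> u = m \<cdot> v"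
  shows "u = v"
  using assms unfolding monic_def in_hom_def by metis

lemma monic_comp:
  assumes "monic C m" "in_hom C m a b" "monic C n" "in_hom C n b c"
  shows "monic C (n \<cdot> m)"
proof (rule monicI)
  show "in_hom C (n \<cdot> m) a c" using assms comp_in_hom by blast
  fix x u v
  assume u: "in_hom C u x a" and v: "in_hom C v x a" and eq: "n \<cdot> m \<cdot> u = n \<cdot> m \<cdot> v"
  have "n \<cdot> (m \<cdot> u) = n \<cdot> (m \<cdot> v)"
    using eq comp_assoc[OF u assms(2,4)] comp_assoc[OF v assms(2,4)] by simp
  then have "m \<cdot> u = m \<cdot> v"
    using monic_cancel[OF assms(3,4)] comp_in_hom u v assms(2) by blast
  then show "u = v" using monic_cancel[OF assms(1,2) u v] by blast
qed

lemma isoE: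
  assumes "iso C f" "in_hom C f a b"
  obtains g where "in_hom C g b a" "g \<cdot> f = Ident C a" "f \<cdot> g = Ident C b"
  using assms unfolding iso_def in_hom_def by metis

lemma isoI:
  assumes "in_hom C f a b" "in_hom C g b a" "g \<cdot> f = Ident C a" "f \<cdot> g = Ident C b"
  shows "iso C f"
  using assms unfolding iso_def in_hom_def by metis

lemma iso_ident: "a \<in> Obj C \<Longrightarrow> iso C (Ident C a)"
  using isoI ident_in_hom comp_ident by metis

lemma retractionI:
  assumes "in_hom C e a b" "in_hom C s b a" "e \<cdot> s = Ident C b"
  shows "retraction C e"
  using assms unfolding retraction_def in_hom_def by metis

lemma extremal_epi_iso:
  assumes "extremal_epi C e" "in_hom C e a b" "monic C m" "in_hom C m x b" "in_hom C g a x"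
    and "e = m \<cdot> g"
  shows "iso C m"
  using assms unfolding extremal_epi_def in_hom_def by metis

text \<open>A monic with a right inverse is an isomorphism.\<close>

lemma extremal_epi_ident:
  assumes "a \<in> Obj C"
  shows "extremal_epi C (Ident C a)"
  unfolding extremal_epi_def
proof (intro conjI allI impI)
  note ida = ident_in_hom[OF assms]
  show "Ident C a \<in> Arr C" using in_hom_arr[OF ida] .
  fix m g
  assume m: "monic C m" and g: "in_hom C g (Dom C (Ident C a)) (Dom C m)"
    and cod: "Cod C m = Cod C (Ident C a)" and eq: "Ident C a = m \<cdot> g"
  have m': "in_hom C m (Dom C m) a" and g': "in_hom C g a (Dom C m)"
    using m g cod ida unfolding monic_def in_hom_def by simp_all
  have "m \<cdot> (g \<cdot> m) = m \<cdot> Ident C (Dom C m)"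
    using comp_assoc[OF m' g' m'] eq ident_comp[OF m'] comp_ident[OF m'] by simp
  then have "g \<cdot> m = Ident C (Dom C m)"
    using monic_cancel[OF m m' comp_in_hom[OF m' g'] ident_hom[OF m']] by blast
  then show "iso C m" using isoI[OF m' g'] eq by simp
qed

lemma pullback_squareI:
  assumes "in_hom C p x a" "in_hom C q x b" "in_hom C f a c" "in_hom C g b c" "f \<cdot> p = g \<cdot> q"
    and "\<And>y u v. in_hom C u y a \<Longrightarrow> in_hom C v y b \<Longrightarrow> f \<cdot> u = g \<cdot> v \<Longrightarrow>
      \<exists>h. in_hom C h y x \<and> p \<cdot> h = u \<and> q \<cdot> h = v"
    and "\<And>y h k. in_hom C h y x \<Longrightarrow> in_hom C k y x \<Longrightarrow> p \<cdot> h = p \<cdot> k \<Longrightarrow> q \<cdot> h = q \<cdot> k \<Longrightarrow> h = k"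
  shows "pullback_square C p q f g"
proof -
  have "\<exists>!h. in_hom C h y x \<and> p \<cdot> h = u \<and> q \<cdot> h = v"
    if "in_hom C u y a" "in_hom C v y b" "f \<cdot> u = g \<cdot> v" for y u v
    using assms(6)[OF that] assms(7) by metis
  then show ?thesis
    using assms(1-5) unfolding pullback_square_def by (simp add: in_hom_def)
qed

lemma pullback_square_commutes: "pullback_square C p q f g \<Longrightarrow> f \<cdot> p = g \<cdot> q"
  by (simp add: pullback_square_def)

lemma pullback_square_lift:
  assumes "pullback_square C p q f g" "in_hom C p x a" "in_hom C q x b"
    and "in_hom C u y a" "in_hom C v y b" "f \<cdot> u = g \<cdot> v"
  obtains h where "in_hom C h y x" "p \<cdot> h = u" "q \<cdot> h = v"
  using assms unfolding pullback_square_def by (metis in_hom_def)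

lemma pullback_square_joint_monic:
  assumes pb: "pullback_square C p q f g" "in_hom C p x a" "in_hom C q x b"
    and h: "in_hom C h y x" and k: "in_hom C k y x" and eq: "p \<cdot> h = p \<cdot> k" "q \<cdot> h = q \<cdot> k"
  shows "h = k"
proof -
  have f: "in_hom C f a (Cod C f)" and g: "in_hom C g b (Cod C f)" and D: "Dom C p = x"
    using pb unfolding pullback_square_def in_hom_def by auto
  have ph: "in_hom C (p \<cdot> h) y (Dom C f)" and qh: "in_hom C (q \<cdot> h) y (Dom C g)"
    using comp_in_hom h pb(2,3) in_hom_dom[OF f] in_hom_dom[OF g] by blast+
  have "f \<cdot> (p \<cdot> h) = g \<cdot> (q \<cdot> h)"
    using comp_assoc[OF h pb(2) f] comp_assoc[OF h pb(3) g] pullback_square_commutes[OF pb(1)]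
    by simp
  then have "\<exists>!l. in_hom C l y (Dom C p) \<and> p \<cdot> l = p \<cdot> h \<and> q \<cdot> l = q \<cdot> h"
    using pb(1) ph qh unfolding pullback_square_def by blast
  then show ?thesis using h k eq D by metis
qed

lemma pullback_monic:
  assumes pb: "pullback_square C p q f g" and p: "in_hom C p x a" and q: "in_hom C q x b"
    and f: "in_hom C f a c" and g: "in_hom C g b c" and mono: "monic C g"
  shows "monic C p"
proof (rule monicI[OF p])
  fix y u v
  assume u: "in_hom C u y x" and v: "in_hom C v y x" and eq: "p \<cdot> u = p \<cdot> v"
  have "g \<cdot> (q \<cdot> u) = g \<cdot> (q \<cdot> v)"
    using pullback_square_commutes[OF pb] eq
      comp_assoc[OF u q g] comp_assoc[OF v q g] comp_assoc[OF u p f] comp_assoc[OF v p f] by simp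
  then have "q \<cdot> u = q \<cdot> v"
    using monic_cancel[OF mono g] comp_in_hom q u v by blast
  then show "u = v" using pullback_square_joint_monic[OF pb p q u v eq] by blast
qed

section \<open>Inclusion of subobjects, ascending chains and Noetherian objects\<close>

lemma factors_throughI: "in_hom C v (Dom C k) (Dom C m) \<Longrightarrow> m \<cdot> v = k \<Longrightarrow> factors_through C k m"
  unfolding factors_through_def by blast

lemma factors_throughE:
  assumes "factors_through C k m" "in_hom C k a c" "in_hom C m b c"
  obtains v where "in_hom C v a b" "k = m \<cdot> v"
  using assms unfolding factors_through_def in_hom_def by metis

lemma factors_through_refl: "in_hom C k a c \<Longrightarrow> factors_through C k k"
  using factors_throughI comp_ident ident_hom in_hom_dom by metis

lemma factors_through_trans:
  assumes "factors_through C k l" "factors_through C l m"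
    and "in_hom C k a d" "in_hom C l b d" "in_hom C m c d"
  shows "factors_through C k m"
proof -
  obtain v where v: "in_hom C v a b" "k = l \<cdot> v" using factors_throughE assms by metis
  obtain w where w: "in_hom C w b c" "l = m \<cdot> w" using factors_throughE assms by metis
  show ?thesis
    using factors_throughI[of "w \<cdot> v" k m] comp_in_hom[OF v(1) w(1)] comp_assoc[OF v(1) w(1) assms(5)]
      v w in_hom_dom assms(3,5) by metis
qed

lemma chain_factors_through:
  fixes k :: "nat \<Rightarrow> 'm"
  assumes k: "\<And>n. in_hom C (k n) (K n) c" and step: "\<And>n. factors_through C (k n) (k (Suc n))"
    and "i \<le> j"
  shows "factors_through C (k i) (k j)"
  using \<open>i \<le> j\<close>
proof (induction j rule: dec_induct)
  case base
  show ?case using factors_through_refl k by blast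
next
  case (step n)
  then show ?case using factors_through_trans assms(2) k by blast
qed

text \<open>The functors of the definition amount to ascending sequences of monics, since arrows
  between monics of the slice are unique.\<close>

lemma noetherian_imp_acc:
  assumes N: "noetherian_object C c" and mon: "\<And>n. monic C (k n)"
    and k: "\<And>n. in_hom C (k n) (K n) c" and step: "\<And>n. factors_through C (k n) (k (Suc n))"
  shows "\<exists>N. \<forall>n\<ge>N. factors_through C (k n) (k N)"
proof -
  have "\<forall>i j. i \<le> j \<longrightarrow> (\<exists>v. in_hom C v (K i) (K j) \<and> k i = k j \<cdot> v)"
    using factors_throughE[OF chain_factors_through[of k K c, OF k step] k k] by metis
  then obtain f where f: "\<And>i j. i \<le> j \<Longrightarrow> in_hom C (f i j) (K i) (K j)"
    and kf: "\<And>i j. i \<le> j \<Longrightarrow> k i = k j \<cdot> f i j"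
    by metis
  \<comment> \<open>The arrows \<open>f i j\<close> were chosen separately for each pair;
    functoriality follows by cancelling the monics \<open>k i\<close> and
    \<open>k l\<close>.\<close>
  have f_id: "f i i = Ident C (K i)" for i
    using monic_cancel[OF mon k f[of i i] ident_hom[OF k]] kf[of i i] comp_ident[OF k] by simp
  have f_comp: "f i l = f j l \<cdot> f i j" if "i \<le> j" "j \<le> l" for i j l
  proof -
    note fij = f[OF that(1)] and fjl = f[OF that(2)] and il = le_trans[OF that]
    have "k l \<cdot> f i l = k l \<cdot> (f j l \<cdot> f i j)"
      using kf[OF that(1)] kf[OF that(2)] kf[OF il] comp_assoc[OF fij fjl k] by simp
    then show ?thesis
      using monic_cancel[OF mon k f[OF il] comp_in_hom[OF fij fjl]] by blast
  qed
  define F where "F = (\<lambda>(i, j). (k i, f i j, k j))"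
  have "is_functor nat_poset (slice C c) k F"
    unfolding is_functor_def in_hom_nat_poset
  proof (intro conjI ballI allI impI)
    fix n assume "n \<in> Obj nat_poset"
    show "k n \<in> Obj (slice C c)"
      using in_hom_arr[OF k] in_hom_cod[OF k] by (simp add: slice_def)
    show "F (Ident nat_poset n) = Ident (slice C c) (k n)"
      using f_id in_hom_dom[OF k] by (simp add: slice_def nat_poset_def F_def)
  next
    fix u :: "nat \<times> nat" and i j assume "u = (i, j) \<and> i \<le> j"
    then show "in_hom (slice C c) (F u) (k i) (k j)"
      unfolding in_hom_slice using in_hom_arr[OF k] in_hom_cod[OF k] in_hom_dom[OF k] f kf[symmetric]
      by (simp add: F_def)
  next
    fix u v :: "nat \<times> nat" and i j l assume "u = (i, j) \<and> i \<le> j" "v = (j, l) \<and> j \<le> l"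
    then show "F (v \<cdot>\<^bsub>nat_poset\<^esub> u) = F v \<cdot>\<^bsub>slice C c\<^esub> F u"
      using f_comp[of i j l] by (simp add: slice_def nat_poset_def F_def)
  qed
  then obtain N where iso: "\<And>j. N \<le> j \<Longrightarrow> iso (slice C c) (F (N, j))"
    using N mon unfolding noetherian_object_def by blast
  \<comment> \<open>The inverse of \<open>F (N, j)\<close> in the slice is an arrow over
    \<open>c\<close> from \<open>k j\<close> to \<open>k N\<close>.\<close>
  have "factors_through C (k j) (k N)" if "N \<le> j" for j
    using iso[OF that] unfolding iso_def F_def in_hom_slice factors_through_def
    by (auto simp: slice_def)
  then show ?thesis by blast
qed

lemma acc_imp_noetherian:
  assumes c: "c \<in> Obj C"
    and acc: "\<And>k K. (\<And>n. monic C (k n)) \<Longrightarrow> (\<And>n. in_hom C (k n) (K n) c) \<Longrightarrow>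
      (\<And>n. factors_through C (k n) (k (Suc n))) \<Longrightarrow>
      \<exists>N::nat. \<forall>n\<ge>N. factors_through C (k n) (k N)"
  shows "noetherian_object C c"
  unfolding noetherian_object_def
proof (intro conjI allI impI c)
  fix k Fm
  assume F: "is_functor nat_poset (slice C c) k Fm" and mon: "\<forall>n. monic C (k n)"
  define K where "K n = Dom C (k n)" for n
  have k: "in_hom C (k n) (K n) c" for n
    using F unfolding is_functor_def K_def by (simp add: nat_poset_def slice_def in_hom_def)
  have "\<exists>f. Fm (i, j) = (k i, f, k j) \<and> in_hom C f (K i) (K j) \<and> k j \<cdot> f = k i" if "i \<le> j" for i j
  proof -
    have "in_hom (slice C c) (Fm (i, j)) (k i) (k j)"
      using F that unfolding is_functor_def in_hom_nat_poset by blast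
    then show ?thesis unfolding in_hom_slice K_def by blast
  qed
  then obtain f where Fm: "\<And>i j. i \<le> j \<Longrightarrow> Fm (i, j) = (k i, f i j, k j)"
    and f: "\<And>i j. i \<le> j \<Longrightarrow> in_hom C (f i j) (K i) (K j)"
    and kf: "\<And>i j. i \<le> j \<Longrightarrow> k j \<cdot> f i j = k i"
    by metis
  have ft: "factors_through C (k i) (k j)" if "i \<le> j" for i j
    using factors_throughI f[OF that] kf[OF that] K_def by metis
  obtain N where N: "\<And>n. N \<le> n \<Longrightarrow> factors_through C (k n) (k N)"
    using acc[of k K] mon k ft[OF le_SucI[OF order_refl]] by blast
  have "iso (slice C c) (Fm (i, j))" if ij: "N \<le> i" "i \<le> j" for i j
  proof -
    \<comment> \<open>Since \<open>k j\<close> lies below \<open>k N\<close>, it lies below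
      \<open>k i\<close>. The inclusions in both directions are mutually inverse, because the monics
      can be cancelled.\<close>
    have "factors_through C (k j) (k i)"
      using factors_through_trans[OF N ft k k k] ij by (meson order_trans)
    then obtain g where g: "in_hom C g (K j) (K i)" "k j = k i \<cdot> g"
      using factors_throughE k by metis
    note fij = f[OF ij(2)]
    have "k i \<cdot> (g \<cdot> f i j) = k i \<cdot> Ident C (K i)" "k j \<cdot> (f i j \<cdot> g) = k j \<cdot> Ident C (K j)"
      using comp_assoc[OF fij g(1) k] comp_assoc[OF g(1) fij k] comp_ident[OF k[of i]]
        comp_ident[OF k[of j]] kf[OF ij(2)] g(2)
      by simp_all
    then have "g \<cdot> f i j = Ident C (K i)" "f i j \<cdot> g = Ident C (K j)"
      using monic_cancel[OF mon[rule_format] k] comp_in_hom[OF fij g(1)] comp_in_hom[OF g(1) fij]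
        ident_hom[OF k] by blast+
    then have "in_hom (slice C c) (k j, g, k i) (k j) (k i)
      \<and> (k j, g, k i) \<cdot>\<^bsub>slice C c\<^esub> (k i, f i j, k j) = Ident (slice C c) (k i)
      \<and> (k i, f i j, k j) \<cdot>\<^bsub>slice C c\<^esub> (k j, g, k i) = Ident (slice C c) (k j)"
      "in_hom (slice C c) (k i, f i j, k j) (k i) (k j)"
      using fij g k[of i] k[of j] kf[OF ij(2)] unfolding in_hom_slice
      by (auto simp: slice_def in_hom_def)
    then show ?thesis
      unfolding iso_def Fm[OF ij(2)] by (auto simp: in_hom_def)
  qed
  then show "\<exists>N. \<forall>i j. N \<le> i \<longrightarrow> i \<le> j \<longrightarrow> iso (slice C c) (Fm (i, j))" by blast
qed

text \<open>Composition with \<open>m\<close> turns subobjects of \<open>a\<close> into subobjects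
  of \<open>b\<close>, and it preserves and reflects inclusion.\<close>

lemma noetherian_subobject:
  assumes N: "noetherian_object C b" and m: "in_hom C m a b" "monic C m"
  shows "noetherian_object C a"
proof (rule acc_imp_noetherian)
  show "a \<in> Obj C" using in_hom_dom_obj m by blast
  fix k K
  assume mon: "\<And>n. monic C (k n)" and k: "\<And>n. in_hom C (k n) (K n) a"
    and step: "\<And>n. factors_through C (k n) (k (Suc n))"
  have mk: "in_hom C (m \<cdot> k n) (K n) b" for n using comp_in_hom k m by blast
  have iff: "factors_through C (m \<cdot> k i) (m \<cdot> k j) \<longleftrightarrow> factors_through C (k i) (k j)" for i j
  proof -
    have "m \<cdot> k i = m \<cdot> k j \<cdot> v \<longleftrightarrow> k i = k j \<cdot> v" if v: "in_hom C v (K i) (K j)" for v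
      using comp_assoc[OF v k m(1)] monic_cancel[OF m(2,1) k comp_in_hom[OF v k]] by auto
    then show ?thesis
      unfolding factors_through_def in_hom_dom[OF k] in_hom_dom[OF mk] by blast
  qed
  show "\<exists>N. \<forall>n\<ge>N. factors_through C (k n) (k N)"
    using noetherian_imp_acc[OF N, of "\<lambda>n. m \<cdot> k n" K] monic_comp[OF mon k m(2,1)] mk step iff
    by blast
qed

end

section \<open>Images, extremal epimorphisms and covers in a regular category\<close>

locale regular_protomodular = category +
  assumes regular: "regular_category C" and protomodular: "protomodular_category C"
begin

lemma pullback_exists:
  assumes "in_hom C f a c" "in_hom C g b c"
  obtains x p q where "in_hom C p x a" "in_hom C q x b" "pullback_square C p q f g"
proof -
  have "has_pullbacks C" using protomodular unfolding protomodular_category_def by blast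
  then obtain p q where "pullback_square C p q f g"
    using assms unfolding has_pullbacks_def in_hom_def by metis
  moreover from this have "in_hom C p (Dom C p) a" "in_hom C q (Dom C p) b"
    using assms unfolding pullback_square_def in_hom_def by auto
  ultimately show ?thesis using that by blast
qed

lemma image_factorization:
  assumes "in_hom C f a b"
  obtains x m e where "in_hom C e a x" "in_hom C m x b" "monic C m" "stably_extremal_epi C e" "f = m \<cdot> e"
proof -
  obtain m e where *: "monic C m" "stably_extremal_epi C e" "Cod C e = Dom C m" "f = m \<cdot> e"
    using assms regular unfolding regular_category_def in_hom_def by metis
  then have m: "in_hom C m (Dom C m) (Cod C m)" and e: "in_hom C e (Dom C e) (Dom C m)"
    unfolding monic_def stably_extremal_epi_def in_hom_def by auto
  have "Dom C e = a" "Cod C m = b"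
    using comp_in_hom[OF e m] *(4) assms unfolding in_hom_def by auto
  then show ?thesis using that m e * by metis
qed

text \<open>This replaces the choice of preimages of elements: \<open>u\<close> lifts along
  \<open>e\<close> after composition with \<open>q\<close>, the pullback of \<open>e\<close> along
  \<open>u\<close>.\<close>

lemma stably_extremal_cover:
  assumes "stably_extremal_epi C e" "in_hom C e a b" "in_hom C u x b"
  obtains y q w where "in_hom C q y x" "in_hom C w y a" "extremal_epi C q" "e \<cdot> w = u \<cdot> q"
proof -
  obtain y q w where *: "in_hom C q y x" "in_hom C w y a" "pullback_square C q w u e"
    using pullback_exists assms by metis
  then show ?thesis
    using that assms(1) pullback_square_commutes unfolding stably_extremal_epi_def by metis
qed

text \<open>Inclusion may be tested after an extremal epimorphism: \<open>q\<close> factors through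
  the pullback \<open>p\<close> of \<open>m\<close> along \<open>k\<close>, which is monic and hence
  invertible.\<close>

lemma extremal_factor:
  assumes q: "extremal_epi C q" "in_hom C q y x" and k: "in_hom C k x c"
    and m: "monic C m" "in_hom C m b c" and v: "in_hom C v y b" and eq: "k \<cdot> q = m \<cdot> v"
  shows "factors_through C k m"
proof -
  obtain z p r where p: "in_hom C p z x" and r: "in_hom C r z b" and pb: "pullback_square C p r k m"
    using pullback_exists[OF k m(2)] by metis
  obtain h where h: "in_hom C h y z" "p \<cdot> h = q"
    using pullback_square_lift[OF pb p r q(2) v eq] by metis
  have "iso C p"
    using extremal_epi_iso[OF q pullback_monic[OF pb p r k m(2,1)] p h(1)] h(2) by simp
  then obtain s where s: "in_hom C s x z" "p \<cdot> s = Ident C x" using isoE p by metis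
  have "m \<cdot> (r \<cdot> s) = k"
    using comp_assoc[OF s(1) r m(2)] comp_assoc[OF s(1) p k] s(2) comp_ident[OF k]
      pullback_square_commutes[OF pb] by simp
  then show ?thesis
    using factors_throughI[of "r \<cdot> s"] comp_in_hom[OF s(1) r] in_hom_dom k m(2) by metis
qed

text \<open>If \<open>m\<close> is a monic through which the composite factors, then
  \<open>extremal_factor\<close> first removes \<open>q\<close>, and extremality of \<open>r\<close>
  makes \<open>m\<close> invertible.\<close>

lemma extremal_epi_comp:
  assumes q: "extremal_epi C q" "in_hom C q a b" and r: "extremal_epi C r" "in_hom C r b c"
  shows "extremal_epi C (r \<cdot> q)"
  unfolding extremal_epi_def
proof (intro conjI allI impI)
  note rq = comp_in_hom[OF q(2) r(2)]
  show "r \<cdot> q \<in> Arr C" using in_hom_arr[OF rq] .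
  fix m g
  assume m: "monic C m" and g: "in_hom C g (Dom C (r \<cdot> q)) (Dom C m)"
    and cod: "Cod C m = Cod C (r \<cdot> q)" and eq: "r \<cdot> q = m \<cdot> g"
  have m': "in_hom C m (Dom C m) c"
    using m cod in_hom_cod[OF rq] unfolding monic_def in_hom_def by simp
  have "factors_through C r m"
    using extremal_factor[OF q r(2) m m' _ eq] g in_hom_dom[OF rq] by simp
  then show "iso C m"
    using factors_throughE[OF _ r(2) m'] extremal_epi_iso[OF r m m'] by metis
qed

text \<open>The limit of the empty diagram. Pullbacks over it serve as binary products in
  \<open>extremal_epi_cancel\<close>.\<close>

lemma terminal_object_exists:
  obtains t where "terminal_object C t"
proof -
  define J :: "(nat, nat) cat"
    where "J = \<lparr>Obj = {}, Arr = {}, Dom = id, Cod = id, Ident = id, Comp = (\<lambda>x y. x)\<rparr>"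
  have J: "Obj J = {}" "Arr J = {}" by (auto simp: J_def)
  have "category J" by unfold_locales (auto simp: J in_hom_def)
  \<comment> \<open>On the empty category any values form a functor; \<open>undefined\<close> is an
    arbitrary choice.\<close>
  moreover have "is_functor J C (\<lambda>_. undefined) (\<lambda>_. undefined)"
    unfolding is_functor_def by (auto simp: J in_hom_def)
  ultimately obtain t \<pi> where "limit_cone J C (\<lambda>_. undefined) (\<lambda>_. undefined) t \<pi>"
    using regular J unfolding regular_category_def finitely_complete_def
    by (metis finite.emptyI)
  then have "terminal_object C t"
    unfolding limit_cone_def cone_def terminal_object_def by (auto simp: J in_hom_def)
  then show ?thesis using that by blast
qed

text \<open>Extremal epimorphisms are epic: the pair \<open>h\<close> of \<open>u\<close> and
  \<open>v\<close>, composed with \<open>q\<close>, lands in the diagonal of the product of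
  \<open>w\<close> with itself. The diagonal is monic, so \<open>h\<close> lands there
  already.\<close>

lemma extremal_epi_cancel:
  assumes q: "extremal_epi C q" "in_hom C q y x" and u: "in_hom C u x w" and v: "in_hom C v x w"
    and eq: "u \<cdot> q = v \<cdot> q"
  shows "u = v"
proof -
  obtain t where t: "terminal_object C t" using terminal_object_exists by blast
  then obtain \<tau> where \<tau>: "in_hom C \<tau> w t"
    using in_hom_cod_obj[OF u] unfolding terminal_object_def by blast
  \<comment> \<open>Over a terminal object the pullback \<open>P\<close> is the product of
    \<open>w\<close> with itself.\<close>
  obtain P p r where p: "in_hom C p P w" and r: "in_hom C r P w" and pb: "pullback_square C p r \<tau> \<tau>"
    using pullback_exists[OF \<tau> \<tau>] by metis
  have lift: "\<exists>h. in_hom C h a P \<and> p \<cdot> h = f \<and> r \<cdot> h = g" if fg: "in_hom C f a w" "in_hom C g a w" for a f g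
  proof -
    have "\<tau> \<cdot> f = \<tau> \<cdot> g"
      using t comp_in_hom[OF fg(1) \<tau>] comp_in_hom[OF fg(2) \<tau>] in_hom_dom_obj[OF fg(1)]
      unfolding terminal_object_def by blast
    then show ?thesis using pullback_square_lift[OF pb p r fg] by metis
  qed
  note id = ident_hom[OF \<tau>]
  obtain \<delta> where \<delta>: "in_hom C \<delta> w P" "p \<cdot> \<delta> = Ident C w" "r \<cdot> \<delta> = Ident C w"
    using lift[OF id id] by blast
  obtain h where h: "in_hom C h x P" "p \<cdot> h = u" "r \<cdot> h = v"
    using lift[OF u v] by blast
  have mono: "monic C \<delta>"
  proof (rule monicI[OF \<delta>(1)])
    fix a f g
    assume f: "in_hom C f a w" and g: "in_hom C g a w" and "\<delta> \<cdot> f = \<delta> \<cdot> g"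
    then show "f = g"
      using comp_assoc[OF f \<delta>(1) p] comp_assoc[OF g \<delta>(1) p] \<delta>(2) ident_comp by metis
  qed
  note uq = comp_in_hom[OF q(2) u]
  have "h \<cdot> q = \<delta> \<cdot> (u \<cdot> q)"
  proof (rule pullback_square_joint_monic[OF pb p r comp_in_hom[OF q(2) h(1)] comp_in_hom[OF uq \<delta>(1)]])
    show "p \<cdot> (h \<cdot> q) = p \<cdot> (\<delta> \<cdot> (u \<cdot> q))"
      using comp_assoc[OF q(2) h(1) p] comp_assoc[OF uq \<delta>(1) p] \<delta> h ident_comp[OF uq] by simp
    show "r \<cdot> (h \<cdot> q) = r \<cdot> (\<delta> \<cdot> (u \<cdot> q))"
      using comp_assoc[OF q(2) h(1) r] comp_assoc[OF uq \<delta>(1) r] \<delta> h ident_comp[OF uq] eq by simp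
  qed
  then have "factors_through C h \<delta>"
    using extremal_factor[OF q h(1) mono \<delta>(1) uq] by blast
  then obtain s where s: "in_hom C s x w" "h = \<delta> \<cdot> s"
    using factors_throughE h(1) \<delta>(1) by metis
  show ?thesis
    using h s comp_assoc[OF s(1) \<delta>(1) p] comp_assoc[OF s(1) \<delta>(1) r] \<delta> by simp
qed

text \<open>An arrow is its own pullback along an identity.\<close>

lemma stably_extremal_imp_extremal:
  assumes e: "stably_extremal_epi C e" "in_hom C e a b"
  shows "extremal_epi C e"
proof -
  have "pullback_square C e (Ident C a) (Ident C b) e"
  proof (rule pullback_squareI)
    show "in_hom C e a b" "in_hom C e a b" by (rule e)+
    show "in_hom C (Ident C a) a a" "in_hom C (Ident C b) b b"
      using e in_hom_dom_obj in_hom_cod_obj ident_in_hom by blast+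
    show "Ident C b \<cdot> e = e \<cdot> Ident C a" using e ident_comp comp_ident by metis
  qed (metis ident_comp)+
  then show ?thesis using e unfolding stably_extremal_epi_def by blast
qed

text \<open>The image factorization reduces the claim to stably extremal epimorphisms. As
  \<open>m\<close> is monic, \<open>g\<close> coequalizes the same pair as \<open>e\<close>, which
  gives \<open>k\<close> with \<open>k \<cdot> e = g\<close>. Then \<open>k\<close> is a section of
  \<open>m\<close>, and a lift of \<open>k \<cdot> u\<close> along \<open>g\<close> is a lift of
  \<open>u\<close> along \<open>e\<close>.\<close>

lemma regular_epi_cover:
  assumes e: "regular_epi C e" "in_hom C e a b" and u: "in_hom C u x b"
  obtains y q w where "in_hom C q y x" "in_hom C w y a" "extremal_epi C q" "e \<cdot> w = u \<cdot> q"
proof -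
  obtain i m g where g: "in_hom C g a i" "stably_extremal_epi C g" and m: "in_hom C m i b" "monic C m"
    and emg: "e = m \<cdot> g"
    using image_factorization[OF e(2)] by metis
  obtain r s t where st: "in_hom C s r a" "in_hom C t r a" "e \<cdot> s = e \<cdot> t"
    and univ: "\<And>x h. in_hom C h a x \<Longrightarrow> h \<cdot> s = h \<cdot> t \<Longrightarrow> \<exists>!k. in_hom C k b x \<and> k \<cdot> e = h"
    using e(1) unfolding regular_epi_def in_hom_dom[OF e(2)] in_hom_cod[OF e(2)] by blast
  have "m \<cdot> (g \<cdot> s) = m \<cdot> (g \<cdot> t)"
    using st emg comp_assoc[OF st(1) g(1) m(1)] comp_assoc[OF st(2) g(1) m(1)] by simp
  then have "g \<cdot> s = g \<cdot> t"
    using monic_cancel[OF m(2,1)] comp_in_hom st g(1) by blast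
  then obtain k where k: "in_hom C k b i" "k \<cdot> e = g" using univ g(1) by blast
  note mk = comp_in_hom[OF k(1) m(1)]
  note idb = ident_in_hom[OF in_hom_cod_obj[OF e(2)]]
  have "m \<cdot> k \<cdot> e = Ident C b \<cdot> e"
    using comp_assoc[OF e(2) k(1) m(1)] k emg ident_comp[OF e(2)] by simp
  \<comment> \<open>Both sides are factorizations of \<open>e\<close> through itself, and these are
    unique.\<close>
  then have mk_id: "m \<cdot> k = Ident C b"
    using univ[OF e(2) st(3)] mk idb ident_comp[OF e(2)] by metis
  note ku = comp_in_hom[OF u k(1)]
  obtain y q w where *: "in_hom C q y x" "in_hom C w y a" "extremal_epi C q" "g \<cdot> w = k \<cdot> u \<cdot> q"
    using stably_extremal_cover[OF g(2,1) ku] by metis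
  have "e \<cdot> w = m \<cdot> (k \<cdot> u) \<cdot> q"
    using comp_assoc[OF *(2) g(1) m(1)] comp_assoc[OF *(1) ku m(1)] *(4) emg by simp
  also have "m \<cdot> (k \<cdot> u) = u"
    using comp_assoc[OF u k(1) m(1)] mk_id ident_comp[OF u] by simp
  finally show ?thesis using that * by blast
qed

section \<open>Preimages of chains and regular quotients\<close>

text \<open>The pullbacks of the \<open>k n\<close> along \<open>e\<close> ascend in
  \<open>a\<close>. The conclusion speaks of arrows \<open>w\<close> into \<open>a\<close>, so that
  its applications need not handle these pullbacks.\<close>

lemma preimage_chain_stabilizes:
  assumes N: "noetherian_object C a" and e: "in_hom C e a b"
    and mon: "\<And>n. monic C (k n)" and k: "\<And>n. in_hom C (k n) (K n) b"
    and step: "\<And>n. factors_through C (k n) (k (Suc n))"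
  shows "\<exists>N. \<forall>n\<ge>N. \<forall>x w v. in_hom C w x a \<longrightarrow> in_hom C v x (K n) \<longrightarrow> e \<cdot> w = k n \<cdot> v \<longrightarrow>
    (\<exists>v'. in_hom C v' x (K N) \<and> e \<cdot> w = k N \<cdot> v')"
proof -
  have "\<exists>L l r. in_hom C l L a \<and> in_hom C r L (K n) \<and> pullback_square C l r e (k n)" for n
    using pullback_exists[OF e k] by metis
  then obtain L l r where l: "\<And>n. in_hom C (l n) (L n) a" and r: "\<And>n. in_hom C (r n) (L n) (K n)"
    and pb: "\<And>n. pullback_square C (l n) (r n) e (k n)"
    by metis
  have lstep: "factors_through C (l n) (l (Suc n))" for n
  proof -
    obtain v where v: "in_hom C v (K n) (K (Suc n))" "k n = k (Suc n) \<cdot> v"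
      using factors_throughE step k by metis
    have "e \<cdot> l n = k (Suc n) \<cdot> (v \<cdot> r n)"
      using pullback_square_commutes[OF pb[of n]] v comp_assoc[OF r v(1) k] by simp
    then show ?thesis
      using pullback_square_lift[OF pb l r l comp_in_hom[OF r v(1)]] factors_throughI in_hom_dom l
      by metis
  qed
  obtain N where N: "\<And>n. N \<le> n \<Longrightarrow> factors_through C (l n) (l N)"
    using noetherian_imp_acc[of a l L, OF assms(1) pullback_monic[OF pb l r e k mon] l lstep] by blast
  have "\<exists>v'. in_hom C v' x (K N) \<and> e \<cdot> w = k N \<cdot> v'"
    if n: "N \<le> n" and w: "in_hom C w x a" and v: "in_hom C v x (K n)" and eq: "e \<cdot> w = k n \<cdot> v" for n x w v
  proof -
    obtain h where h: "in_hom C h x (L n)" "l n \<cdot> h = w"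
      using pullback_square_lift[OF pb l r w v eq] by metis
    obtain g where g: "in_hom C g (L n) (L N)" "l n = l N \<cdot> g"
      using factors_throughE N[OF n] l by metis
    note gh = comp_in_hom[OF h(1) g(1)]
    have "e \<cdot> w = k N \<cdot> (r N \<cdot> (g \<cdot> h))"
      using h g comp_assoc[OF h(1) g(1) l] comp_assoc[OF gh l e] comp_assoc[OF gh r k]
        pullback_square_commutes[OF pb[of N]] by simp
    then show ?thesis using comp_in_hom[OF gh r] by blast
  qed
  then show ?thesis by blast
qed

text \<open>Some extremal epimorphism \<open>q\<close> onto \<open>K n\<close> makes
  \<open>k n \<cdot> q\<close> lift to \<open>a\<close>. There the preimages have stabilized, and
  \<open>extremal_factor\<close> removes \<open>q\<close>.\<close>

lemma noetherian_regular_quotient: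
  assumes N: "noetherian_object C a" and e: "in_hom C e a b" "regular_epi C e"
  shows "noetherian_object C b"
proof (rule acc_imp_noetherian)
  show "b \<in> Obj C" using e in_hom_cod_obj by blast
  fix k K
  assume mon: "\<And>n. monic C (k n)" and k: "\<And>n. in_hom C (k n) (K n) b"
    and step: "\<And>n. factors_through C (k n) (k (Suc n))"
  obtain N where N: "\<And>n x w v. N \<le> n \<Longrightarrow> in_hom C w x a \<Longrightarrow> in_hom C v x (K n) \<Longrightarrow>
    e \<cdot> w = k n \<cdot> v \<Longrightarrow> \<exists>v'. in_hom C v' x (K N) \<and> e \<cdot> w = k N \<cdot> v'"
    using preimage_chain_stabilizes[of a e b k K, OF assms(1) e(1) mon k step] by blast
  have "factors_through C (k n) (k N)" if n: "N \<le> n" for n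
  proof -
    obtain y q w where q: "in_hom C q y (K n)" "extremal_epi C q" and w: "in_hom C w y a" "e \<cdot> w = k n \<cdot> q"
      using regular_epi_cover[OF e(2,1) k[of n]] by metis
    obtain v where v: "in_hom C v y (K N)" "k n \<cdot> q = k N \<cdot> v"
      using N[OF n w(1) q(1) w(2)] w(2) by auto
    show ?thesis by (rule extremal_factor[OF q(2,1) k mon k v])
  qed
  then show "\<exists>N. \<forall>n\<ge>N. factors_through C (k n) (k N)" by blast
qed

section \<open>Protomodularity and weak extensions\<close>

lemma protomodular_iso:
  assumes "in_hom C m' a' b'" "in_hom C e' b' c'" "in_hom C m a b" "in_hom C e b c"
    and "in_hom C \<alpha> a' a" "in_hom C \<beta> b' b" "in_hom C \<gamma> c' c"
    and "pullback_square C m' \<alpha> \<beta> m" "e \<cdot> \<beta> = \<gamma> \<cdot> e'"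
    and "in_hom C \<theta> w c" "pullback_square C m h e \<theta>"
    and "retraction C e" "retraction C e'" "iso C \<alpha>" "iso C \<gamma>"
  shows "iso C \<beta>"
  using protomodular assms unfolding protomodular_category_def by blast

text \<open>The case in which \<open>\<alpha>\<close> and \<open>\<gamma>\<close> are identities.
  The left square is a pullback because \<open>\<beta>\<close> is monic, and \<open>s\<close> and
  \<open>\<beta> \<cdot> s\<close> are sections of \<open>e'\<close> and \<open>e\<close>.\<close>

lemma protomodular_iso_over:
  assumes m': "in_hom C m' a b'" and e': "in_hom C e' b' c" and m: "in_hom C m a b"
    and e: "in_hom C e b c" and \<beta>: "in_hom C \<beta> b' b" "monic C \<beta>" "\<beta> \<cdot> m' = m"
    and over: "e \<cdot> \<beta> = e'" and s: "in_hom C s c b'" "e' \<cdot> s = Ident C c"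
    and pb: "in_hom C \<theta> w c" "pullback_square C m h e \<theta>"
  shows "iso C \<beta>"
proof (rule protomodular_iso[OF m' e' m e _ \<beta>(1) _ _ _ pb])
  note ida = ident_hom[OF m]
  show "in_hom C (Ident C a) a a" "in_hom C (Ident C c) c c" "iso C (Ident C a)" "iso C (Ident C c)"
    using ida ident_hom[OF s(1)] iso_ident in_hom_dom_obj[OF m] in_hom_dom_obj[OF s(1)] by auto
  show "pullback_square C m' (Ident C a) \<beta> m"
  proof (rule pullback_squareI[OF m' ida \<beta>(1) m])
    show "\<beta> \<cdot> m' = m \<cdot> Ident C a" using \<beta>(3) comp_ident[OF m] by simp
    fix y u v
    assume u: "in_hom C u y b'" and v: "in_hom C v y a" and eq: "\<beta> \<cdot> u = m \<cdot> v"
    have "\<beta> \<cdot> (m' \<cdot> v) = \<beta> \<cdot> u" using eq \<beta>(3) comp_assoc[OF v m' \<beta>(1)] by simp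
    then have "m' \<cdot> v = u" using monic_cancel[OF \<beta>(2,1) comp_in_hom[OF v m'] u] by blast
    then show "\<exists>h. in_hom C h y a \<and> m' \<cdot> h = u \<and> Ident C a \<cdot> h = v" using v ident_comp by metis
  qed (metis ident_comp)
  show "e \<cdot> \<beta> = Ident C c \<cdot> e'" using over ident_comp[OF e'] by simp
  show "retraction C e'" using retractionI e' s by blast
  show "retraction C e"
    using retractionI[OF e comp_in_hom[OF s(1) \<beta>(1)]] comp_assoc[OF s(1) \<beta>(1) e] over s(2) by simp
qed

text \<open>Protomodularity is applied to \<open>K \<times>\<^sub>c K \<rightarrow> K \<times>\<^sub>c L\<close>, both regarded as split epimorphisms over \<open>K\<close>: the pullback
  of this arrow along \<open>K \<times>\<^sub>c d \<rightarrow> K\<close> is invertible.\<close>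

lemma weak_extension_lift:
  assumes \<phi>: "in_hom C \<phi> d c" and g: "in_hom C g L c" and t: "in_hom C t K L" "monic C t"
    and lift: "\<And>x l v. in_hom C l x L \<Longrightarrow> in_hom C v x d \<Longrightarrow> g \<cdot> l = \<phi> \<cdot> v \<Longrightarrow>
      \<exists>h. in_hom C h x K \<and> t \<cdot> h = l"
    and l: "in_hom C l x L" and h: "in_hom C h x K" and eq: "g \<cdot> t \<cdot> h = g \<cdot> l"
  shows "\<exists>h'. in_hom C h' x K \<and> t \<cdot> h' = l"
proof -
  define f where "f = g \<cdot> t"
  have f: "in_hom C f K c" unfolding f_def using comp_in_hom t g by blast
  \<comment> \<open>Here \<open>R\<close>, \<open>S\<close> and \<open>D\<close> are
    \<open>K \<times>\<^sub>c K\<close>, \<open>K \<times>\<^sub>c L\<close> and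
    \<open>K \<times>\<^sub>c d\<close>. The pullback \<open>A\<close> of \<open>S\<close> and
    \<open>D\<close> over \<open>K\<close> is
    \<open>K \<times>\<^sub>c L \<times>\<^sub>c d\<close>.\<close>
  obtain R r1 r2 where r1: "in_hom C r1 R K" and r2: "in_hom C r2 R K" and R: "pullback_square C r1 r2 f f"
    using pullback_exists[OF f f] by metis
  obtain S s1 s2 where s1: "in_hom C s1 S K" and s2: "in_hom C s2 S L" and S: "pullback_square C s1 s2 f g"
    using pullback_exists[OF f g] by metis
  obtain D \<theta> \<psi> where \<theta>: "in_hom C \<theta> D K" and \<psi>: "in_hom C \<psi> D d" and D: "pullback_square C \<theta> \<psi> f \<phi>"
    using pullback_exists[OF f \<phi>] by metis
  obtain A m n where m: "in_hom C m A S" and n: "in_hom C n A D" and A: "pullback_square C m n s1 \<theta>"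
    using pullback_exists[OF s1 \<theta>] by metis
  have "f \<cdot> r1 = g \<cdot> (t \<cdot> r2)"
    using pullback_square_commutes[OF R] comp_assoc[OF r2 t(1) g] unfolding f_def by simp
  \<comment> \<open>The arrow \<open>\<beta>\<close> is the identity on the first component and
    \<open>t\<close> on the second, so it is an arrow over \<open>K\<close>.\<close>
  then obtain \<beta> where \<beta>: "in_hom C \<beta> R S" "s1 \<cdot> \<beta> = r1" "s2 \<cdot> \<beta> = t \<cdot> r2"
    using pullback_square_lift[OF S s1 s2 r1 comp_in_hom[OF r2 t(1)]] by metis
  have \<beta>_mono: "monic C \<beta>"
  proof (rule monicI[OF \<beta>(1)])
    fix y u v
    assume u: "in_hom C u y R" and v: "in_hom C v y R" and eq: "\<beta> \<cdot> u = \<beta> \<cdot> v"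
    have "r1 \<cdot> u = r1 \<cdot> v"
      using eq comp_assoc[OF u \<beta>(1) s1] comp_assoc[OF v \<beta>(1) s1] \<beta>(2) by simp
    moreover have "t \<cdot> (r2 \<cdot> u) = t \<cdot> (r2 \<cdot> v)"
      using eq comp_assoc[OF u \<beta>(1) s2] comp_assoc[OF v \<beta>(1) s2] \<beta>(3)
        comp_assoc[OF u r2 t(1)] comp_assoc[OF v r2 t(1)] by simp
    then have "r2 \<cdot> u = r2 \<cdot> v"
      using monic_cancel[OF t(2,1)] comp_in_hom u v r2 by blast
    ultimately show "u = v" using pullback_square_joint_monic[OF R r1 r2 u v] by blast
  qed
  note s2m = comp_in_hom[OF m s2] and s1m = comp_in_hom[OF m s1] and \<psi>n = comp_in_hom[OF n \<psi>]
  have fs: "f \<cdot> (s1 \<cdot> m) = g \<cdot> (s2 \<cdot> m)"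
    using comp_assoc[OF m s1 f] comp_assoc[OF m s2 g] pullback_square_commutes[OF S] by simp
  also have "f \<cdot> (s1 \<cdot> m) = \<phi> \<cdot> (\<psi> \<cdot> n)"
    using pullback_square_commutes[OF A] comp_assoc[OF n \<theta> f] comp_assoc[OF n \<psi> \<phi>]
      pullback_square_commutes[OF D] by simp
  \<comment> \<open>On \<open>A\<close> the image in \<open>c\<close> of the component in
    \<open>L\<close> lifts to \<open>d\<close>, so \<open>lift\<close> puts that component into
    \<open>K\<close>. This makes \<open>m\<close> factor through \<open>\<beta>\<close>.\<close>
  finally obtain w where w: "in_hom C w A K" "t \<cdot> w = s2 \<cdot> m"
    using lift[OF s2m \<psi>n] by metis
  have "f \<cdot> (s1 \<cdot> m) = f \<cdot> w"
    using fs w comp_assoc[OF w(1) t(1) g] unfolding f_def by simp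
  then obtain m' where m': "in_hom C m' A R" "r1 \<cdot> m' = s1 \<cdot> m" "r2 \<cdot> m' = w"
    using pullback_square_lift[OF R r1 r2 s1m w(1)] by metis
  have \<beta>m': "\<beta> \<cdot> m' = m"
    using pullback_square_joint_monic[OF S s1 s2 comp_in_hom[OF m'(1) \<beta>(1)] m]
      comp_assoc[OF m'(1) \<beta>(1) s1] comp_assoc[OF m'(1) \<beta>(1) s2] comp_assoc[OF m'(1) r2 t(1)]
      \<beta> m' w(2) by simp
  note idK = ident_hom[OF f]
  \<comment> \<open>The diagonal, as a section of \<open>r1\<close>.\<close>
  obtain \<delta> where \<delta>: "in_hom C \<delta> K R" "r1 \<cdot> \<delta> = Ident C K"
    using pullback_square_lift[OF R r1 r2 idK idK refl] by metis
  have "iso C \<beta>"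
    by (rule protomodular_iso_over[OF m'(1) r1 m s1 \<beta>(1) \<beta>_mono \<beta>m' \<beta>(2) \<delta> \<theta> A])
  then obtain \<beta>' where \<beta>': "in_hom C \<beta>' S R" "\<beta> \<cdot> \<beta>' = Ident C S" using isoE \<beta>(1) by metis
  \<comment> \<open>The arrow \<open>j\<close> pairs \<open>h\<close> with \<open>l\<close>. The
    inverse of \<open>\<beta>\<close> moves it into \<open>K \<times>\<^sub>c K\<close>, where the
    second component is the desired arrow.\<close>
  obtain j where j: "in_hom C j x S" "s2 \<cdot> j = l"
    using pullback_square_lift[OF S s1 s2 h l] eq unfolding f_def by metis
  note b = comp_in_hom[OF j(1) \<beta>'(1)]
  have "t \<cdot> (r2 \<cdot> (\<beta>' \<cdot> j)) = s2 \<cdot> (\<beta> \<cdot> (\<beta>' \<cdot> j))"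
    using comp_assoc[OF b r2 t(1)] comp_assoc[OF b \<beta>(1) s2] \<beta>(3) by simp
  also have "\<beta> \<cdot> (\<beta>' \<cdot> j) = j"
    using comp_assoc[OF j(1) \<beta>'(1) \<beta>(1)] \<beta>'(2) ident_comp[OF j(1)] by simp
  finally show ?thesis using j(2) comp_in_hom[OF b r2] by blast
qed

lemma noetherian_weak_extension:
  assumes f': "in_hom C f' a d" and \<phi>': "in_hom C \<phi>' a b" and f: "in_hom C f b c" and \<phi>: "in_hom C \<phi> d c"
    and pb: "pullback_square C \<phi>' f' f \<phi>" and Na: "noetherian_object C a" and Nc: "noetherian_object C c"
  shows "noetherian_object C b"
proof (rule acc_imp_noetherian)
  show "b \<in> Obj C" using f in_hom_dom_obj by blast
  fix k K
  assume mon: "\<And>n. monic C (k n)" and k: "\<And>n. in_hom C (k n) (K n) b"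
    and step: "\<And>n. factors_through C (k n) (k (Suc n))"
  obtain N1 where N1: "\<And>n x w v. N1 \<le> n \<Longrightarrow> in_hom C w x a \<Longrightarrow> in_hom C v x (K n) \<Longrightarrow>
    \<phi>' \<cdot> w = k n \<cdot> v \<Longrightarrow> \<exists>v'. in_hom C v' x (K N1) \<and> \<phi>' \<cdot> w = k N1 \<cdot> v'"
    using preimage_chain_stabilizes[of a \<phi>' b k K, OF Na \<phi>' mon k step] by blast
  note fk = comp_in_hom[OF k f]
  have "\<exists>I i e. in_hom C e (K n) I \<and> in_hom C i I c \<and> monic C i \<and> stably_extremal_epi C e \<and> f \<cdot> k n = i \<cdot> e" for n
    using image_factorization[OF fk] by metis
  then obtain I i e where e: "\<And>n. in_hom C (e n) (K n) (I n)" "\<And>n. stably_extremal_epi C (e n)"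
    and i: "\<And>n. in_hom C (i n) (I n) c" "\<And>n. monic C (i n)" and ie: "\<And>n. f \<cdot> k n = i n \<cdot> e n"
    by metis
  \<comment> \<open>The image of \<open>K n\<close> under \<open>f\<close> lies in that of
    \<open>K (Suc n)\<close>: test this after the extremal epimorphism \<open>e n\<close>.\<close>
  have istep: "factors_through C (i n) (i (Suc n))" for n
  proof -
    obtain v where v: "in_hom C v (K n) (K (Suc n))" "k n = k (Suc n) \<cdot> v"
      using factors_throughE step k by metis
    have "i n \<cdot> e n = i (Suc n) \<cdot> (e (Suc n) \<cdot> v)"
      using ie[of n] ie[of "Suc n"] v comp_assoc[OF v(1) k f] comp_assoc[OF v(1) e(1) i(1)] by simp
    then show ?thesis
      using extremal_factor[OF stably_extremal_imp_extremal[OF e(2,1)] e(1) i(1,2,1) comp_in_hom[OF v(1) e(1)]]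
      by blast
  qed
  obtain N2 where N2: "\<And>n. N2 \<le> n \<Longrightarrow> factors_through C (i n) (i N2)"
    using noetherian_imp_acc[of c i I, OF Nc i(2,1) istep] by blast
  have le: "factors_through C (k p) (k n)" if "p \<le> n" for p n
    by (rule chain_factors_through[of k K b, OF k step that])
  have ile: "factors_through C (i p) (i n)" if "p \<le> n" for p n
    by (rule chain_factors_through[of i I c, OF i(1) istep that])
  \<comment> \<open>From \<open>N\<close> on, both the preimages in \<open>a\<close> and the images
    in \<open>c\<close> are constant.\<close>
  define N where "N = max N1 N2"
  have "factors_through C (k n) (k N)" if n: "N \<le> n" for n
  proof -
    obtain t where t: "in_hom C t (K N) (K n)" "k N = k n \<cdot> t"
      using factors_throughE le[OF n] k by metis
    have t_mono: "monic C t"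
    proof (rule monicI[OF t(1)])
      fix x u v
      assume u: "in_hom C u x (K N)" and v: "in_hom C v x (K N)" and "t \<cdot> u = t \<cdot> v"
      then show "u = v"
        using monic_cancel[OF mon k u v] t comp_assoc[OF u t(1) k] comp_assoc[OF v t(1) k] by simp
    qed
    \<comment> \<open>An arrow into \<open>K n\<close> whose image in \<open>c\<close> lifts to
      \<open>d\<close> comes from \<open>a\<close> by the pullback square; stability of the
      preimages then moves it into \<open>K N1\<close>, hence into \<open>K N\<close>.\<close>
    have lift: "\<exists>h. in_hom C h x (K N) \<and> t \<cdot> h = l"
      if l: "in_hom C l x (K n)" and v: "in_hom C v x d" and eq: "f \<cdot> k n \<cdot> l = \<phi> \<cdot> v" for x l v
    proof -
      note kl = comp_in_hom[OF l k]
      obtain w where w: "in_hom C w x a" "\<phi>' \<cdot> w = k n \<cdot> l"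
        using pullback_square_lift[OF pb \<phi>' f' kl v] eq comp_assoc[OF l k f] by metis
      have "N1 \<le> n" using n by (simp add: N_def)
      then obtain v' where v': "in_hom C v' x (K N1)" "k n \<cdot> l = k N1 \<cdot> v'"
        using N1[OF _ w(1) l w(2)] w(2) by auto
      obtain g where g: "in_hom C g (K N1) (K N)" "k N1 = k N \<cdot> g"
        using factors_throughE le[of N1 N] k unfolding N_def by (metis max.cobounded1)
      note gv = comp_in_hom[OF v'(1) g(1)]
      have "k n \<cdot> (t \<cdot> (g \<cdot> v')) = k n \<cdot> l"
        using v' g t comp_assoc[OF v'(1) g(1) k] comp_assoc[OF gv t(1) k] by simp
      then show ?thesis using monic_cancel[OF mon k comp_in_hom[OF gv t(1)] l] gv by blast
    qed
    have "factors_through C (i n) (i N)"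
      using factors_through_trans[OF N2 ile i(1) i(1) i(1)] n unfolding N_def by simp
    then obtain s where s: "in_hom C s (I n) (I N)" "i n = i N \<cdot> s"
      using factors_throughE i(1) by metis
    note se = comp_in_hom[OF e(1) s(1)]
    \<comment> \<open>The images of \<open>K n\<close> and \<open>K N\<close> agree, so after a
      cover \<open>q\<close> each arrow into \<open>K n\<close> has a partner \<open>w\<close> in
      \<open>K N\<close> with the same value in \<open>c\<close>.\<close>
    obtain y q w where q: "in_hom C q y (K n)" "extremal_epi C q" and w: "in_hom C w y (K N)"
      and eq: "e N \<cdot> w = s \<cdot> e n \<cdot> q"
      using stably_extremal_cover[OF e(2,1) se] by metis
    have "f \<cdot> k n \<cdot> t \<cdot> w = i N \<cdot> (e N \<cdot> w)"
      using comp_assoc[OF t(1) k f] t(2) ie[of N] comp_assoc[OF w e(1) i(1)] by simp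
    also have "\<dots> = f \<cdot> k n \<cdot> q"
      using eq ie[of n] s(2) comp_assoc[OF q(1) se i(1)] comp_assoc[OF e(1) s(1) i(1)] by simp
    finally have "f \<cdot> k n \<cdot> t \<cdot> w = f \<cdot> k n \<cdot> q" .
    then have "\<exists>h. in_hom C h y (K N) \<and> t \<cdot> h = q"
      by (intro weak_extension_lift[OF \<phi> fk t(1) t_mono _ q(1) w] lift)
    then obtain h where h: "in_hom C h y (K N)" "t \<cdot> h = q" by blast
    show ?thesis
      using extremal_factor[OF q(2,1) k mon k h(1)] h(2) t comp_assoc[OF h(1) t(1) k] by simp
  qed
  then show "\<exists>N. \<forall>n\<ge>N. factors_through C (k n) (k N)" by blast
qed

section \<open>Noetherian objects are Hopfian\<close>

text \<open>Over \<open>I\<close> the kernel pair of \<open>e\<close> is just the diagonal, by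
  \<open>triv\<close>. Protomodularity spreads this from \<open>I\<close> to all of
  \<open>c\<close>, so the two projections coincide.\<close>

lemma monic_of_trivial_preimage:
  assumes e: "in_hom C e c b" and i: "in_hom C i I c"
    and triv: "\<And>x u v. in_hom C u x c \<Longrightarrow> in_hom C v x I \<Longrightarrow> e \<cdot> u = e \<cdot> (i \<cdot> v) \<Longrightarrow> u = i \<cdot> v"
  shows "monic C e"
proof -
  obtain R r1 r2 where r1: "in_hom C r1 R c" and r2: "in_hom C r2 R c" and R: "pullback_square C r1 r2 e e"
    using pullback_exists[OF e e] by metis
  note idc = ident_hom[OF e] and idI = ident_hom[OF i]
  obtain \<delta> where \<delta>: "in_hom C \<delta> c R" "r1 \<cdot> \<delta> = Ident C c" "r2 \<cdot> \<delta> = Ident C c"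
    using pullback_square_lift[OF R r1 r2 idc idc refl] by metis
  have r\<delta>: "r1 \<cdot> (\<delta> \<cdot> u) = u" "r2 \<cdot> (\<delta> \<cdot> u) = u" if u: "in_hom C u x c" for u x
    using comp_assoc[OF u \<delta>(1) r1] comp_assoc[OF u \<delta>(1) r2] \<delta>(2,3) ident_comp[OF u] by simp_all
  have mono: "monic C \<delta>" using monicI[OF \<delta>(1)] r\<delta> by metis
  note \<delta>i = comp_in_hom[OF i \<delta>(1)]
  \<comment> \<open>If the first component of a pair in \<open>R\<close> lies in \<open>I\<close>,
    then \<open>triv\<close> makes the second component equal to it.\<close>
  have "pullback_square C (\<delta> \<cdot> i) (Ident C I) r1 i"
  proof (rule pullback_squareI[OF \<delta>i idI r1 i])
    show "r1 \<cdot> (\<delta> \<cdot> i) = i \<cdot> Ident C I" using r\<delta>(1)[OF i] comp_ident[OF i] by simp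
    fix y u v
    assume u: "in_hom C u y R" and v: "in_hom C v y I" and eq: "r1 \<cdot> u = i \<cdot> v"
    note iv = comp_in_hom[OF v i]
    have "e \<cdot> (r2 \<cdot> u) = e \<cdot> (i \<cdot> v)"
      using eq comp_assoc[OF u r1 e] comp_assoc[OF u r2 e] pullback_square_commutes[OF R] by simp
    then have r2u: "r2 \<cdot> u = i \<cdot> v" using triv[OF comp_in_hom[OF u r2] v] by blast
    have "\<delta> \<cdot> (i \<cdot> v) = u"
      using pullback_square_joint_monic[OF R r1 r2 comp_in_hom[OF iv \<delta>(1)] u] r\<delta>[OF iv] eq r2u by simp
    then show "\<exists>h. in_hom C h y I \<and> \<delta> \<cdot> i \<cdot> h = u \<and> Ident C I \<cdot> h = v"
      using v comp_assoc[OF v i \<delta>(1)] ident_comp[OF v] by metis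
  qed (metis ident_comp)
  then have "iso C \<delta>"
    using protomodular_iso_over[OF i idc \<delta>i r1 \<delta>(1) mono refl \<delta>(2) idc comp_ident[OF idc] i] by blast
  then obtain \<delta>' where \<delta>': "in_hom C \<delta>' R c" "\<delta> \<cdot> \<delta>' = Ident C R" using isoE \<delta>(1) by metis
  have r12: "r1 = r2"
    using comp_assoc[OF \<delta>'(1) \<delta>(1) r1] comp_assoc[OF \<delta>'(1) \<delta>(1) r2] \<delta> \<delta>'(2) comp_ident[OF r1]
      comp_ident[OF r2] by simp
  show ?thesis
    using monicI[OF e] pullback_square_lift[OF R r1 r2] r12 by metis
qed

lemma noetherian_imp_hopfian:
  assumes z: "initial_object C z" and N: "noetherian_object C c"
  shows "hopfian_object C c"
  unfolding hopfian_object_def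
proof (intro conjI allI impI)
  show c: "c \<in> Obj C" using N unfolding noetherian_object_def by blast
  fix e
  assume e: "in_hom C e c c" and se: "stably_extremal_epi C e"
  obtain z' where z': "in_hom C z' z c" and z'_unique: "\<And>y. in_hom C y z c \<Longrightarrow> y = z'"
    using z c unfolding initial_object_def by metis
  obtain I i j where j: "in_hom C j z I" "stably_extremal_epi C j" and i: "in_hom C i I c" "monic C i"
    and ij: "z' = i \<cdot> j"
    using image_factorization[OF z'] by metis
  \<comment> \<open>Both sides are arrows from the initial object to \<open>c\<close>.\<close>
  have eij: "e \<cdot> i \<cdot> j = i \<cdot> j"
    using z'_unique[OF comp_in_hom[OF z' e]] ij comp_assoc[OF j(1) i(1) e] by simp
  have ei: "e \<cdot> i = i"
    using extremal_epi_cancel[OF stably_extremal_imp_extremal[OF j(2,1)] j(1) comp_in_hom[OF i(1) e] i(1) eij] .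
  \<comment> \<open>These are the powers of \<open>e\<close>, starting with the identity at
    \<open>0\<close>.\<close>
  define E where "E n = ((\<lambda>f. e \<cdot> f) ^^ n) (Ident C c)" for n
  have E_Suc: "E (Suc n) = e \<cdot> E n" for n by (simp add: E_def)
  have E: "in_hom C (E n) c c" for n
  proof (induction n)
    case 0
    show ?case using ident_in_hom[OF c] by (simp add: E_def)
  next
    case (Suc n)
    then show ?case using comp_in_hom[OF _ e] E_Suc by simp
  qed
  \<comment> \<open>Each power of \<open>e\<close> is surjective in the sense of
    \<open>stably_extremal_cover\<close>; lifting along \<open>e\<close> once per induction step
    composes the extremal epimorphisms.\<close>
  have cover: "\<exists>y q w. in_hom C q y x \<and> in_hom C w y c \<and> extremal_epi C q \<and> E n \<cdot> w = u \<cdot> q"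
    if "in_hom C u x c" for n u x
    using that
  proof (induction n arbitrary: u x)
    case 0
    have "E 0 \<cdot> u = u \<cdot> Ident C x" using ident_comp[OF 0] comp_ident[OF 0] by (simp add: E_def)
    moreover have "extremal_epi C (Ident C x)"
      using extremal_epi_ident in_hom_dom_obj[OF 0] by blast
    ultimately show ?case using ident_hom[OF 0] 0 by blast
  next
    case (Suc n)
    obtain y q w where q: "in_hom C q y x" "extremal_epi C q" and w: "in_hom C w y c" "e \<cdot> w = u \<cdot> q"
      using stably_extremal_cover[OF se e Suc.prems] by metis
    obtain y' q' w' where q': "in_hom C q' y' y" "extremal_epi C q'"
      and w': "in_hom C w' y' c" "E n \<cdot> w' = w \<cdot> q'"
      using Suc.IH[OF w(1)] by metis
    have "E (Suc n) \<cdot> w' = u \<cdot> (q \<cdot> q')"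
      using comp_assoc[OF w'(1) E e] w'(2) comp_assoc[OF q'(1) w(1) e] w(2)
        comp_assoc[OF q'(1) q(1) Suc.prems] by (simp add: E_Suc)
    then show ?case
      using extremal_epi_comp[OF q'(2,1) q(2,1)] comp_in_hom[OF q'(1) q(1)] w'(1) by blast
  qed
  have "\<exists>K k r. in_hom C k K c \<and> in_hom C r K I \<and> pullback_square C k r (E n) i" for n
    using pullback_exists[OF E i(1)] by metis
  then obtain K k r where k: "\<And>n. in_hom C (k n) (K n) c" and r: "\<And>n. in_hom C (r n) (K n) I"
    and pb: "\<And>n. pullback_square C (k n) (r n) (E n) i"
    by metis
  \<comment> \<open>Since \<open>e \<cdot> i = i\<close>, whatever \<open>E n\<close> sends into
    \<open>I\<close> is also sent there by \<open>E (Suc n)\<close>.\<close>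
  have "factors_through C (k n) (k (Suc n))" for n
  proof -
    have "E (Suc n) \<cdot> k n = i \<cdot> r n"
      using comp_assoc[OF k E e] pullback_square_commutes[OF pb[of n]] comp_assoc[OF r i(1) e] ei
      by (simp add: E_Suc)
    then show ?thesis
      using pullback_square_lift[OF pb k r k r] factors_throughI in_hom_dom[OF k] by metis
  qed
  \<comment> \<open>One stationary step of the chain suffices.\<close>
  then obtain n where "factors_through C (k (Suc n)) (k n)"
    using noetherian_imp_acc[of c k K, OF N pullback_monic[OF pb k r E i(1,2)] k] by (meson le_SucI order_refl)
  then obtain g where g: "in_hom C g (K (Suc n)) (K n)" "k (Suc n) = k n \<cdot> g"
    using factors_throughE k by metis
  have triv: "u = i \<cdot> v" if u: "in_hom C u x c" and v: "in_hom C v x I" and eq: "e \<cdot> u = e \<cdot> (i \<cdot> v)"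
    for x u v
  proof -
    have eu: "e \<cdot> u = i \<cdot> v" using eq comp_assoc[OF v i(1) e] ei by simp
    obtain y q w where q: "in_hom C q y x" "extremal_epi C q" and w: "in_hom C w y c" "E n \<cdot> w = u \<cdot> q"
      using cover[OF u] by metis
    have "E (Suc n) \<cdot> w = i \<cdot> (v \<cdot> q)"
      using comp_assoc[OF w(1) E e] w(2) comp_assoc[OF q(1) u e] eu comp_assoc[OF q(1) v i(1)]
      by (simp add: E_Suc)
    then obtain h where h: "in_hom C h y (K (Suc n))" "k (Suc n) \<cdot> h = w"
      using pullback_square_lift[OF pb k r w(1) comp_in_hom[OF q(1) v]] by metis
    note gh = comp_in_hom[OF h(1) g(1)]
    \<comment> \<open>The stationary step moves \<open>w\<close> into the preimage of
      \<open>I\<close> under \<open>E n\<close>. Hence \<open>u \<cdot> q\<close>, which is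
      \<open>E n \<cdot> w\<close>, lands in \<open>I\<close>, and so does \<open>u\<close>.\<close>
    have "w = k n \<cdot> (g \<cdot> h)" using h(2) g(2) comp_assoc[OF h(1) g(1) k] by simp
    then have "u \<cdot> q = i \<cdot> (r n \<cdot> (g \<cdot> h))"
      using w(2) comp_assoc[OF gh k[of n] E[of n]] comp_assoc[OF gh r i(1)] pullback_square_commutes[OF pb[of n]]
      by simp
    then have "factors_through C u i"
      using extremal_factor[OF q(2,1) u i(2,1) comp_in_hom[OF gh r]] by blast
    then obtain s where s: "in_hom C s x I" "u = i \<cdot> s" using factors_throughE u i(1) by metis
    have "i \<cdot> s = i \<cdot> v" using eu s comp_assoc[OF s(1) i(1) e] ei by simp
    then show ?thesis using s(2) by simp
  qed
  have "monic C e" by (rule monic_of_trivial_preimage[OF e i(1) triv])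
  \<comment> \<open>A monic extremal epimorphism is invertible: it factors through itself by an
    identity.\<close>
  then show "iso C e"
    using extremal_epi_iso[OF stably_extremal_imp_extremal[OF se e] e _ e ident_in_hom[OF c]]
      comp_ident[OF e] by simp
qed

section \<open>Binary products in the pointed case\<close>

text \<open>The kernel of \<open>\<pi>\<^sub>1\<close> is \<open>b\<close>: the pullback of the zero
  object along \<open>\<pi>\<^sub>1\<close>. Thus \<open>p\<close> is a weak extension with
  \<open>b\<close> as pullback corner and \<open>a\<close> as base.\<close>

lemma noetherian_binary_product:
  assumes "pointed C" and Na: "noetherian_object C a" and Nb: "noetherian_object C b"
    and prod: "binary_product C a b p \<pi>\<^sub>1 \<pi>\<^sub>2"
  shows "noetherian_object C p"
proof -
  obtain o' where init: "initial_object C o'" and final: "terminal_object C o'"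
    using assms(1) unfolding pointed_def by blast
  have a: "a \<in> Obj C" and b: "b \<in> Obj C"
    using Na Nb unfolding noetherian_object_def by auto
  obtain \<phi> where \<phi>: "in_hom C \<phi> o' a" using init a unfolding initial_object_def by blast
  obtain \<tau> where \<tau>: "in_hom C \<tau> b o'" using final b unfolding terminal_object_def by blast
  have \<pi>: "in_hom C \<pi>\<^sub>1 p a" "in_hom C \<pi>\<^sub>2 p b"
    using prod unfolding binary_product_def by auto
  have univ: "\<exists>!h. in_hom C h x p \<and> \<pi>\<^sub>1 \<cdot> h = u \<and> \<pi>\<^sub>2 \<cdot> h = v"
    if "in_hom C u x a" "in_hom C v x b" for x u v
    using prod that unfolding binary_product_def by blast
  \<comment> \<open>The kernel inclusion, with the zero arrow from \<open>b\<close> to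
    \<open>a\<close> as first component and the identity as second.\<close>
  obtain \<iota> where \<iota>: "in_hom C \<iota> b p" "\<pi>\<^sub>1 \<cdot> \<iota> = \<phi> \<cdot> \<tau>" "\<pi>\<^sub>2 \<cdot> \<iota> = Ident C b"
    using univ[OF comp_in_hom[OF \<tau> \<phi>] ident_hom[OF \<tau>]] by blast
  have \<pi>\<iota>: "\<pi>\<^sub>2 \<cdot> (\<iota> \<cdot> h) = h" if "in_hom C h y b" for h y
    using comp_assoc[OF that \<iota>(1) \<pi>(2)] \<iota>(3) ident_comp[OF that] by simp
  have "pullback_square C \<iota> \<tau> \<pi>\<^sub>1 \<phi>"
  proof (rule pullback_squareI[OF \<iota>(1) \<tau> \<pi>(1) \<phi> \<iota>(2)])
    fix y u v
    assume u: "in_hom C u y p" and v: "in_hom C v y o'" and eq: "\<pi>\<^sub>1 \<cdot> u = \<phi> \<cdot> v"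
    note h = comp_in_hom[OF u \<pi>(2)]
    have \<tau>h: "\<tau> \<cdot> (\<pi>\<^sub>2 \<cdot> u) = v"
      using final comp_in_hom[OF h \<tau>] v in_hom_dom_obj[OF u] unfolding terminal_object_def by blast
    have "\<pi>\<^sub>1 \<cdot> (\<iota> \<cdot> (\<pi>\<^sub>2 \<cdot> u)) = \<pi>\<^sub>1 \<cdot> u"
      using comp_assoc[OF h \<iota>(1) \<pi>(1)] \<iota>(2) comp_assoc[OF h \<tau> \<phi>] \<tau>h eq by simp
    then have "\<iota> \<cdot> (\<pi>\<^sub>2 \<cdot> u) = u"
      using univ[OF comp_in_hom[OF u \<pi>(1)] h] comp_in_hom[OF h \<iota>(1)] u \<pi>\<iota>[OF h] by metis
    then show "\<exists>h. in_hom C h y b \<and> \<iota> \<cdot> h = u \<and> \<tau> \<cdot> h = v" using h \<tau>h by blast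
  qed (metis \<pi>\<iota>)
  then show ?thesis
    using noetherian_weak_extension[OF \<tau> \<iota>(1) \<pi>(1) \<phi>] Na Nb by blast
qed

end

theorem corollary2p20:
  fixes C :: "('o, 'm) cat" and z :: 'o
  assumes "regular_category C" and "protomodular_category C" and "initial_object C z"
  shows "(\<forall>c. noetherian_object C c \<longrightarrow> hopfian_object C c) \<and>
         closed_under_subobjects C {c. noetherian_object C c} \<and>
         closed_under_regular_quotients C {c. noetherian_object C c} \<and>
         closed_under_weak_extensions C {c. noetherian_object C c} \<and>
         (pointed C \<longrightarrow> closed_under_binary_products C {c. noetherian_object C c})"
proof -
  interpret category C using assms(1) unfolding regular_category_def by blast
  interpret regular_protomodular C by unfold_locales (rule assms)+
  show ?thesis
    unfolding closed_under_subobjects_def closed_under_regular_quotients_def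
      closed_under_weak_extensions_def closed_under_binary_products_def mem_Collect_eq
    using noetherian_imp_hopfian[OF assms(3)] noetherian_subobject noetherian_regular_quotient
      noetherian_weak_extension noetherian_binary_product
    by (intro conjI allI impI) blast+
qed

end
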